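(* Let $T\ge 1$, let $\mathcal{K}\subseteq\mathbb{R}^n$ be a closed convex set with $\mathbf{0}\in\mathcal{K}$ and $\|\mathbf{x}-\mathbf{y}\|_2\le D$ for all $\mathbf{x},\mathbf{y}\in\mathcal{K}$, and let $f_1,\dots,f_T:\mathcal{K}\to\mathbb{R}$ be convex (differentiable) functions with $\|\nabla f_t(\mathbf{x})\|_2\le G$ for all $\mathbf{x}\in\mathcal{K}$, $t\in[T]$, where $D,G>0$. Let $d_1,\dots,d_T\ge 1$ be arbitrary integer delays and $\bar d=\frac1T\sum_{t=1}^T d_t$. Let $\mathbf{x}_1,\dots,\mathbf{x}_T$ be the decisions played by Delayed OFW for convex losses (defined in the context) run with parameter $\eta=\frac{D}{GT^{3/4}}$. Then for every $\mathbf{x}^\ast\in\mathcal{K}$, $$\sum_{t=1}^T f_t(\mathbf{x}_t)-\sum_{t=1}^T f_t(\mathbf{x}^\ast)\le 7GDT^{3/4}+GD(\bar d+1)T^{1/4}.$$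
   Context: Delayed online convex optimization: in each round $t=1,\dots,T$ the player plays $\mathbf{x}_t\in\mathcal{K}$, then the adversary selects a convex loss $f_t$; the gradient $\nabla f_t(\mathbf{x}_t)$ is revealed at the end of round $t+d_t-1$. Thus at the end of round $t$ the player receives $\{\nabla f_k(\mathbf{x}_k): k\in\mathcal{F}_t\}$, where $\mathcal{F}_t=\{k\in[T]: k+d_k-1=t\}$. Notation: $[T]=\{1,\dots,T\}$. Delayed OFW for convex losses (input $\eta$): choose an arbitrary $\mathbf{y}_1\in\mathcal{K}$, set $\tau=1$, $\bar{\mathbf{g}}_0=\mathbf{0}$. For $t=1,\dots,T$: play $\mathbf{x}_t=\mathbf{y}_\tau$ (with the current value of $\tau$); receive $\{\nabla f_k(\mathbf{x}_k):k\in\mathcal{F}_t\}$; for each $k\in\mathcal{F}_t$ (processed one after another, in any order) do: (i) $\bar{\mathbf{g}}_\tau=\bar{\mathbf{g}}_{\tau-1}+\nabla f_k(\mathbf{x}_k)$ and $F_\tau(\mathbf{y})=\eta\langle\bar{\mathbf{g}}_\tau,\mathbf{y}\rangle+\|\mathbf{y}-\mathbf{y}_1\|_2^2$; (ii) choose $\mathbf{v}_\tau\in\operatorname{argmin}_{\mathbf{y}\in\mathcal{K}}\langle\nabla F_\tau(\mathbf{y}_\tau),\mathbf{y}\rangle$; (iii) $\mathbf{y}_{\tau+1}=\mathbf{y}_\tau+\sigma_\tau(\mathbf{v}_\tau-\mathbf{y}_\tau)$, where $\sigma_\tau\in\operatorname{argmin}_{\sigma\in[0,1]}\langle\sigma(\mathbf{v}_\tau-\mathbf{y}_\tau),\nabla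 F_\tau(\mathbf{y}_\tau)\rangle+\sigma^2\|\mathbf{v}_\tau-\mathbf{y}_\tau\|_2^2$; then set $\tau\leftarrow\tau+1$. *)

theory Defs
  imports "HOL-Analysis.Analysis"
begin

definition arrivals :: "nat \<Rightarrow> (nat \<Rightarrow> nat) \<Rightarrow> nat \<Rightarrow> nat set" where
  "arrivals T d t = {k \<in> {1..T}. k + d k - 1 = t}"

text \<open>The value of the update counter \<open>\<tau>\<close> at the moment the decision of round \<open>t\<close> is played:
  it starts at 1 and is incremented once per gradient received in an earlier round.\<close>

definition counter :: "nat \<Rightarrow> (nat \<Rightarrow> nat) \<Rightarrow> nat \<Rightarrow> nat" where
  "counter T d t = 1 + (\<Sum>s\<in>{1..<t}. card (arrivals T d s))"

definition surrogate :: "real \<Rightarrow> 'a::real_inner \<Rightarrow> 'a \<Rightarrow> 'a \<Rightarrow> real" where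
  "surrogate \<eta> y1 g y = \<eta> * (g \<bullet> y) + (norm (y - y1))\<^sup>2"

text \<open>The \<open>\<tau>\<close>-th update of Delayed OFW, processing the received gradient \<open>h\<close>; the vector \<open>p\<close> is the
  gradient of the current surrogate at the current iterate. The minimisers need not be unique, so an
  update is a relation on the sequences \<open>g\<close>, \<open>y\<close>, \<open>v\<close>, \<open>\<sigma>\<close> rather than a function.\<close>

definition ofw_update ::
  "'a::real_inner set \<Rightarrow> real \<Rightarrow> (nat \<Rightarrow> 'a) \<Rightarrow> (nat \<Rightarrow> 'a) \<Rightarrow> (nat \<Rightarrow> 'a) \<Rightarrow> (nat \<Rightarrow> real) \<Rightarrow> nat \<Rightarrow> 'a \<Rightarrow> bool"
where
  "ofw_update K \<eta> g y v \<sigma> \<tau> h \<longleftrightarrow>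
     g \<tau> = g (\<tau> - 1) + h \<and>
     (\<exists>p. (GDERIV (surrogate \<eta> (y 1) (g \<tau>)) (y \<tau>) :> p) \<and>
          is_arg_min (\<lambda>z. p \<bullet> z) (\<lambda>z. z \<in> K) (v \<tau>) \<and>
          is_arg_min (\<lambda>s. (s *\<^sub>R (v \<tau> - y \<tau>)) \<bullet> p + s\<^sup>2 * (norm (v \<tau> - y \<tau>))\<^sup>2)
                     (\<lambda>s. s \<in> {0..1}) (\<sigma> \<tau>)) \<and>
     y (\<tau> + 1) = y \<tau> + \<sigma> \<tau> *\<^sub>R (v \<tau> - y \<tau>)"

text \<open>\<open>x\<close> is a sequence of decisions that Delayed OFW may play when \<open>grad k\<close> is the gradient of the
  \<open>k\<close>-th loss. The list \<open>order t\<close> is the order in which the gradients arriving at the end of round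
  \<open>t\<close> are processed. As the losses are unconstrained here, they may have been
  chosen by an adaptive adversary.\<close>

definition delayed_ofw ::
  "nat \<Rightarrow> 'a::real_inner set \<Rightarrow> (nat \<Rightarrow> nat) \<Rightarrow> real \<Rightarrow> (nat \<Rightarrow> 'a \<Rightarrow> 'a) \<Rightarrow> (nat \<Rightarrow> 'a) \<Rightarrow> bool"
where
  "delayed_ofw T K d \<eta> grad x \<longleftrightarrow>
     (\<exists>order g y v \<sigma>.
        y 1 \<in> K \<and> g 0 = 0 \<and>
        (\<forall>t\<in>{1..T}.
           x t = y (counter T d t) \<and>
           distinct (order t) \<and> set (order t) = arrivals T d t \<and>
           (\<forall>j<length (order t).
              ofw_update K \<eta> g y v \<sigma> (counter T d t + j)
                (grad (order t ! j) (x (order t ! j))))))"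

end

theory Submission
  imports Defs
begin

text \<open>The iterates are compared with the minimisers ("leaders") of the surrogates. The leaders have low
  regret and move by at most \<open>\<eta> G / 2\<close> per update; with \<open>q = T powr (1/4)\<close>, the surrogate gap of the
  iterates vanishes initially and never exceeds \<open>4 D\<^sup>2 / q\<^sup>2\<close>, so by strong convexity every iterate
  stays within \<open>2 D / q\<close> of its leader. A delayed round thus costs \<open>\<eta> G\<^sup>2 / 2\<close> for each update made
  between its decision and its own update, and there are at most twice as many such updates
  as the total delay. A round whose gradient never arrives costs at most \<open>G D\<close>, and there are few of
  these unless the total delay is large.\<close>

section \<open>Linearisation of convex losses\<close>

text \<open>By convexity the difference quotients of \<open>f\<close> along the segment from
  \<open>x\<close> to \<open>u\<close> are at most \<open>f u - f x\<close>, and they tend to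
  \<open>f' (u - x)\<close>. The derivative exists only within \<open>K\<close>, so the limit is
  taken over \<open>{0..1}\<close>, where the segment stays in \<open>K\<close>.\<close>

lemma convex_on_above_tangent:
  fixes f :: "'a::real_normed_vector \<Rightarrow> real"
  assumes f: "convex_on K f" and x: "x \<in> K" and u: "u \<in> K"
    and deriv: "(f has_derivative f') (at x within K)"
  shows "f x + f' (u - x) \<le> f u"
proof -
  interpret f': bounded_linear f' using deriv by (rule has_derivative_bounded_linear)
  define w where "w s = x + s *\<^sub>R (u - x)" for s :: real
  have conv: "f (w s) \<le> (1 - s) * f x + s * f u \<and> w s \<in> K" if "s \<in> {0..1}" for s
  proof -
    have "w s = (1 - s) *\<^sub>R x + s *\<^sub>R u" by (simp add: w_def algebra_simps)
    then show ?thesis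
      using convex_onD[OF f, of s x u] convexD_alt[of K x u s] convex_on_imp_convex[OF f] that x u by auto
  qed
  have "((\<lambda>s. f (w s)) has_derivative (\<lambda>s. f' (s *\<^sub>R (u - x)))) (at 0 within {0..1})"
  proof (rule has_derivative_in_compose[of w _ 0 _ f])
    show "(w has_derivative (\<lambda>s. s *\<^sub>R (u - x))) (at 0 within {0..1})"
      unfolding w_def by (auto intro!: derivative_eq_intros)
    show "(f has_derivative f') (at (w 0) within w ` {0..1})"
      by (rule has_derivative_subset[of _ _ _ K]) (use conv deriv in \<open>auto simp: w_def\<close>)
  qed
  moreover have "(\<lambda>s. f' (s *\<^sub>R (u - x))) = (*) (f' (u - x))"
    by (simp add: fun_eq_iff f'.scaleR)
  ultimately have "((\<lambda>s. f (w s)) has_field_derivative f' (u - x)) (at 0 within {0..1})"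
    by (simp add: has_field_derivative_def)
  then have "((\<lambda>s. (f (w s) - f x) / s) \<longlongrightarrow> f' (u - x)) (at 0 within {0..1})"
    by (simp add: has_field_derivative_iff w_def)
  moreover have "\<forall>\<^sub>F s in at 0 within {0..1}. (f (w s) - f x) / s \<le> f u - f x"
    unfolding eventually_at_filter using conv
    by (intro always_eventually) (auto simp: divide_simps algebra_simps)
  moreover have "at (0::real) within {0..1} \<noteq> bot"
    by (simp add: at_within_Icc_at_right)
  ultimately have "f' (u - x) \<le> f u - f x"
    by (intro tendsto_upperbound)
  then show ?thesis by simp
qed

section \<open>Surrogates, their minimisers and a single Frank-Wolfe update\<close>

text \<open>Turns the gradient \<open>p\<close>, which \<open>ofw_update\<close> only asserts to
  exist, into an explicit vector.\<close>

lemma GDERIV_surrogate_unique: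
  assumes "GDERIV (surrogate \<eta> y1 g) y :> p"
  shows "p = \<eta> *\<^sub>R g + 2 *\<^sub>R (y - y1)"
proof -
  have "(surrogate \<eta> y1 g has_derivative (\<lambda>h. h \<bullet> (\<eta> *\<^sub>R g + 2 *\<^sub>R (y - y1)))) (at y)"
    unfolding surrogate_def power2_norm_eq_inner
    by (rule derivative_eq_intros refl | simp add: fun_eq_iff algebra_simps inner_commute)+
  then have "(\<lambda>h. h \<bullet> (\<eta> *\<^sub>R g + 2 *\<^sub>R (y - y1))) = (\<lambda>h. h \<bullet> p)"
    using assms has_derivative_unique unfolding gderiv_def by blast
  then show ?thesis
    by (metis inner_commute vector_eq_ldot)
qed

text \<open>The surrogate is quadratic with Hessian twice the identity, so its second-order
  expansion is exact.\<close>

lemma surrogate_expand: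
  "surrogate \<eta> y1 g (y + w) =
     surrogate \<eta> y1 g y + w \<bullet> (\<eta> *\<^sub>R g + 2 *\<^sub>R (y - y1)) + (norm w)\<^sup>2"
  by (simp add: surrogate_def power2_norm_eq_inner algebra_simps inner_commute)

text \<open>Completing the square, minimising the surrogate over \<open>K\<close> is projecting \<open>y1 - (\<eta>/2) g\<close> onto \<open>K\<close>.\<close>

definition leader :: "'a::euclidean_space set \<Rightarrow> real \<Rightarrow> 'a \<Rightarrow> 'a \<Rightarrow> 'a" where
  "leader K \<eta> y1 g = closest_point K (y1 - (\<eta> / 2) *\<^sub>R g)"

text \<open>Strong convexity at the minimiser: the projection makes an obtuse angle with every
  direction into \<open>K\<close>, so only the quadratic term of the expansion around the leader is
  left as a lower bound.\<close>

lemma surrogate_leader_gap: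
  assumes "closed K" "convex K" "z \<in> K"
  shows "(norm (z - leader K \<eta> y1 g))\<^sup>2 \<le> surrogate \<eta> y1 g z - surrogate \<eta> y1 g (leader K \<eta> y1 g)"
proof -
  define l where "l = leader K \<eta> y1 g"
  have "(y1 - (\<eta> / 2) *\<^sub>R g - l) \<bullet> (z - l) \<le> 0"
    unfolding l_def leader_def using assms by (intro closest_point_dot)
  moreover have "surrogate \<eta> y1 g z - surrogate \<eta> y1 g l =
      (norm (z - l))\<^sup>2 - 2 * ((y1 - (\<eta> / 2) *\<^sub>R g - l) \<bullet> (z - l))"
    by (simp add: surrogate_def power2_norm_eq_inner algebra_simps inner_commute)
  ultimately show ?thesis unfolding l_def by simp
qed

lemma surrogate_leader_le:
  assumes "closed K" "convex K" "z \<in> K"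
  shows "surrogate \<eta> y1 g (leader K \<eta> y1 g) \<le> surrogate \<eta> y1 g z"
  using surrogate_leader_gap[OF assms, of \<eta> y1 g] zero_le_power2[of "norm (z - leader K \<eta> y1 g)"]
  by linarith

text \<open>Projection onto a closed convex set is nonexpansive.\<close>

lemma norm_leader_diff_le:
  assumes "closed K" "convex K" "K \<noteq> {}" "\<eta> \<ge> 0"
  shows "norm (leader K \<eta> y1 g - leader K \<eta> y1 g') \<le> \<eta> / 2 * norm (g - g')"
proof -
  have "norm (leader K \<eta> y1 g - leader K \<eta> y1 g')
      \<le> norm ((y1 - (\<eta> / 2) *\<^sub>R g) - (y1 - (\<eta> / 2) *\<^sub>R g'))"
    unfolding leader_def using closest_point_lipschitz assms by (metis dist_norm)
  also have "\<dots> = norm ((\<eta> / 2) *\<^sub>R (g' - g))"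
    by (rule arg_cong[where f = norm]) (simp add: algebra_simps)
  also have "\<dots> = \<eta> / 2 * norm (g - g')" using assms by (simp add: norm_minus_commute)
  finally show ?thesis .
qed

text \<open>Line search does at least as well as any fixed step \<open>s\<close>, and moving towards
  \<open>v \<tau>\<close> decreases the linear part at least as much as moving towards
  \<open>z\<close> would.\<close>

lemma frank_wolfe_step:
  assumes upd: "ofw_update K \<eta> g y v \<sigma> \<tau> h" and K: "convex K" "y \<tau> \<in> K"
    and diam: "\<And>u w. u \<in> K \<Longrightarrow> w \<in> K \<Longrightarrow> norm (u - w) \<le> D"
  shows "y (\<tau> + 1) \<in> K"
    and "z \<in> K \<Longrightarrow> s \<in> {0..1} \<Longrightarrow>
      surrogate \<eta> (y 1) (g \<tau>) (y (\<tau> + 1)) - surrogate \<eta> (y 1) (g \<tau>) z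
        \<le> (1 - s) * (surrogate \<eta> (y 1) (g \<tau>) (y \<tau>) - surrogate \<eta> (y 1) (g \<tau>) z) + s\<^sup>2 * D\<^sup>2"
proof -
  define p where "p = \<eta> *\<^sub>R g \<tau> + 2 *\<^sub>R (y \<tau> - y 1)"
  define w where "w = v \<tau> - y \<tau>"
  have v: "is_arg_min (\<lambda>z. p \<bullet> z) (\<lambda>z. z \<in> K) (v \<tau>)"
    and \<sigma>: "is_arg_min (\<lambda>s. (s *\<^sub>R w) \<bullet> p + s\<^sup>2 * (norm w)\<^sup>2) (\<lambda>s. s \<in> {0..1}) (\<sigma> \<tau>)"
    and y: "y (\<tau> + 1) = y \<tau> + \<sigma> \<tau> *\<^sub>R w"
    using upd GDERIV_surrogate_unique unfolding ofw_update_def p_def w_def by blast+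
  have vK: "v \<tau> \<in> K" and \<sigma>01: "\<sigma> \<tau> \<in> {0..1}" using v \<sigma> by (auto simp: is_arg_min_def)
  have "y (\<tau> + 1) = (1 - \<sigma> \<tau>) *\<^sub>R y \<tau> + \<sigma> \<tau> *\<^sub>R v \<tau>" unfolding y w_def by (simp add: algebra_simps)
  then show "y (\<tau> + 1) \<in> K" using convexD_alt[of K "y \<tau>" "v \<tau>" "\<sigma> \<tau>"] K vK \<sigma>01 by auto
  let ?F = "surrogate \<eta> (y 1) (g \<tau>)"
  assume z: "z \<in> K" and s: "s \<in> {0..1}"
  \<comment> \<open>The line-search objective is exactly the change of the surrogate.\<close>
  have "?F (y (\<tau> + 1)) = ?F (y \<tau>) + ((\<sigma> \<tau> *\<^sub>R w) \<bullet> p + (\<sigma> \<tau>)\<^sup>2 * (norm w)\<^sup>2)"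
    unfolding y surrogate_expand p_def by (simp add: power_mult_distrib)
  also have "\<dots> \<le> ?F (y \<tau>) + ((s *\<^sub>R w) \<bullet> p + s\<^sup>2 * (norm w)\<^sup>2)"
    using \<sigma> s unfolding is_arg_min_def by (auto simp: not_less)
  also have "(s *\<^sub>R w) \<bullet> p \<le> s * (?F z - ?F (y \<tau>))"
    unfolding inner_scaleR_left
  proof (rule mult_left_mono)
    have "p \<bullet> v \<tau> \<le> p \<bullet> z" using v z unfolding is_arg_min_def by (auto simp: not_less)
    then have "w \<bullet> p \<le> (z - y \<tau>) \<bullet> p" by (simp add: w_def algebra_simps inner_commute)
    also have "\<dots> \<le> ?F z - ?F (y \<tau>)"
      using surrogate_expand[of \<eta> "y 1" "g \<tau>" "y \<tau>" "z - y \<tau>"] by (simp add: p_def)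
    finally show "w \<bullet> p \<le> ?F z - ?F (y \<tau>)" .
  qed (use s in auto)
  also have "s\<^sup>2 * (norm w)\<^sup>2 \<le> s\<^sup>2 * D\<^sup>2"
    using diam[OF vK K(2)] by (intro mult_left_mono power_mono) (auto simp: w_def)
  finally show "?F (y (\<tau> + 1)) - ?F z \<le> (1 - s) * (?F (y \<tau>) - ?F z) + s\<^sup>2 * D\<^sup>2"
    by (simp add: algebra_simps)
qed

section \<open>Regret along the sequence of updates\<close>

text \<open>The updates detached from rounds and delays: \<open>h \<tau>\<close> is the gradient
  consumed by update \<open>\<tau>\<close>. Some gradients may never arrive, so the number
  \<open>N\<close> of updates is kept separate from \<open>q\<close>, which stands for
  \<open>T powr (1/4)\<close>.\<close>

locale ofw_run =
  fixes K :: "'a::euclidean_space set" and D G q \<eta> :: real and g y v h :: "nat \<Rightarrow> 'a"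
    and \<sigma> :: "nat \<Rightarrow> real" and N :: nat
  assumes closed: "closed K" and convex: "convex K"
    and diam: "\<And>u w. u \<in> K \<Longrightarrow> w \<in> K \<Longrightarrow> norm (u - w) \<le> D"
    and D_pos: "D > 0" and G_pos: "G > 0" and q_ge: "q \<ge> 1" and \<eta>_eq: "\<eta> = D / (G * q ^ 3)"
    and y1: "y 1 \<in> K" and g0: "g 0 = 0"
    and update: "\<And>\<tau>. \<tau> \<in> {1..N} \<Longrightarrow> ofw_update K \<eta> g y v \<sigma> \<tau> (h \<tau>)"
    and h_le: "\<And>\<tau>. \<tau> \<in> {1..N} \<Longrightarrow> norm (h \<tau>) \<le> G"
begin

abbreviation F :: "nat \<Rightarrow> 'a \<Rightarrow> real" where "F \<tau> \<equiv> surrogate \<eta> (y 1) (g \<tau>)"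
abbreviation l :: "nat \<Rightarrow> 'a" where "l \<tau> \<equiv> leader K \<eta> (y 1) (g \<tau>)"

lemma \<eta>_pos: "\<eta> > 0"
  using D_pos G_pos q_ge by (simp add: \<eta>_eq)

lemma g_Suc: "\<tau> < N \<Longrightarrow> g (Suc \<tau>) = g \<tau> + h (Suc \<tau>)"
  using update[of "Suc \<tau>"] by (simp add: ofw_update_def)

lemma F_Suc: "\<tau> < N \<Longrightarrow> F (Suc \<tau>) z = F \<tau> z + \<eta> * (h (Suc \<tau>) \<bullet> z)"
  by (simp add: g_Suc surrogate_def algebra_simps)

lemma l_in: "l \<tau> \<in> K"
  using y1 unfolding leader_def by (intro closest_point_in_set closed) auto

lemma l_0: "l 0 = y 1"
  using y1 by (simp add: leader_def g0 closest_point_self)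

lemma norm_l_step: "\<tau> < N \<Longrightarrow> norm (l \<tau> - l (Suc \<tau>)) \<le> \<eta> * G / 2"
proof -
  assume \<tau>: "\<tau> < N"
  have "norm (l \<tau> - l (Suc \<tau>)) \<le> \<eta> / 2 * norm (g \<tau> - g (Suc \<tau>))"
    using closed convex y1 \<eta>_pos by (intro norm_leader_diff_le) auto
  also have "\<dots> \<le> \<eta> / 2 * G"
    using h_le[of "Suc \<tau>"] \<tau> \<eta>_pos by (intro mult_left_mono) (auto simp: g_Suc)
  finally show ?thesis by simp
qed

lemma norm_l_diff:
  assumes "j \<le> i" "i \<le> N"
  shows "norm (l j - l i) \<le> real (i - j) * (\<eta> * G / 2)"
  using assms
proof (induction i rule: dec_induct)
  case (step n)
  have "norm (l j - l (Suc n)) \<le> norm (l j - l n) + norm (l n - l (Suc n))"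
    using norm_triangle_ineq[of "l j - l n" "l n - l (Suc n)"] by simp
  also have "\<dots> \<le> real (n - j) * (\<eta> * G / 2) + \<eta> * G / 2"
    using step norm_l_step[of n] by (intro add_mono) auto
  finally show ?case using step(1) by (simp add: Suc_diff_le distrib_right)
qed simp

lemma gap_imp_norm:
  assumes "z \<in> K" "F \<tau> z - F \<tau> (l \<tau>) \<le> 4 * D\<^sup>2 / q\<^sup>2"
  shows "norm (z - l \<tau>) \<le> 2 * D / q"
proof (rule power2_le_imp_le)
  show "(norm (z - l \<tau>))\<^sup>2 \<le> (2 * D / q)\<^sup>2"
    using surrogate_leader_gap[OF closed convex assms(1), of \<eta> "y 1" "g \<tau>"] assms(2)
    by (simp add: power_mult_distrib power_divide)
qed (use D_pos q_ge in auto)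

text \<open>Adding a gradient raises the gap by at most about \<open>2 D\<^sup>2 / q\<^sup>4\<close>; a Frank-Wolfe step of length
  \<open>2 / q\<^sup>2\<close> (or 1, if \<open>q\<^sup>2 < 2\<close>) compensates for it.\<close>

lemma gap: "i \<le> N \<Longrightarrow> y (Suc i) \<in> K \<and> F i (y (Suc i)) - F i (l i) \<le> 4 * D\<^sup>2 / q\<^sup>2"
proof (induction i)
  case 0
  then show ?case using y1 l_0 D_pos q_ge by simp
next
  case (Suc i)
  then have yK: "y (Suc i) \<in> K" and IH: "F i (y (Suc i)) - F i (l i) \<le> 4 * D\<^sup>2 / q\<^sup>2"
    and i: "i < N" by auto
  define a where "a = 1 / q"
  have a: "0 < a" "a \<le> 1" using q_ge by (auto simp: a_def)
  have \<eta>G: "\<eta> * G = D * a ^ 3" using G_pos by (simp add: \<eta>_eq a_def power_divide)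
  have q2: "4 * D\<^sup>2 / q\<^sup>2 = D\<^sup>2 * (4 * a\<^sup>2)" by (simp add: a_def power_divide)
  \<comment> \<open>The gap after the new gradient has entered the surrogate but before the iterate
    moves.\<close>
  define \<delta> where "\<delta> = F (Suc i) (y (Suc i)) - F (Suc i) (l (Suc i))"
  have "norm (y (Suc i) - l (Suc i)) \<le> norm (y (Suc i) - l i) + norm (l i - l (Suc i))"
    using norm_triangle_ineq[of "y (Suc i) - l i" "l i - l (Suc i)"] by simp
  also have "\<dots> \<le> 2 * D * a + D * a ^ 3 / 2"
    using gap_imp_norm[OF yK IH] norm_l_step[OF i] by (intro add_mono) (auto simp: \<eta>G a_def)
  finally have dist: "norm (y (Suc i) - l (Suc i)) \<le> 2 * D * a + D * a ^ 3 / 2" .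
  have "h (Suc i) \<bullet> (y (Suc i) - l (Suc i)) \<le> norm (h (Suc i)) * norm (y (Suc i) - l (Suc i))"
    by (rule norm_cauchy_schwarz)
  also have "\<dots> \<le> G * (2 * D * a + D * a ^ 3 / 2)"
    using h_le[of "Suc i"] i dist G_pos by (intro mult_mono) auto
  finally have "\<eta> * (h (Suc i) \<bullet> (y (Suc i) - l (Suc i))) \<le> \<eta> * (G * (2 * D * a + D * a ^ 3 / 2))"
    using \<eta>_pos by (intro mult_left_mono) auto
  also have "\<dots> = D * a ^ 3 * (2 * D * a + D * a ^ 3 / 2)" by (simp only: mult.assoc[symmetric] \<eta>G)
  also have "\<dots> = D\<^sup>2 * (2 * a ^ 4 + a ^ 6 / 2)"
    by (simp add: algebra_simps power2_eq_square power3_eq_cube power4_eq_xxxx numeral_eq_Suc)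
  also have "a ^ 6 \<le> a ^ 4" using a by (intro power_decreasing) auto
  finally have "\<eta> * (h (Suc i) \<bullet> (y (Suc i) - l (Suc i))) \<le> D\<^sup>2 * (5 / 2 * a ^ 4)"
    using D_pos by simp
  moreover have "F i (l i) \<le> F i (l (Suc i))"
    using surrogate_leader_le closed convex l_in by blast
  moreover have "\<delta> = F i (y (Suc i)) - F i (l (Suc i)) + \<eta> * (h (Suc i) \<bullet> (y (Suc i) - l (Suc i)))"
    unfolding \<delta>_def F_Suc[OF i] by (simp add: algebra_simps)
  ultimately have \<delta>: "\<delta> \<le> D\<^sup>2 * (4 * a\<^sup>2 + 5 / 2 * a ^ 4)"
    using IH unfolding q2 by (simp add: algebra_simps)
  note step = frank_wolfe_step[OF update[of "Suc i"] convex yK diam]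
  have *: "F (Suc i) (y (Suc (Suc i))) - F (Suc i) (l (Suc i)) \<le> (1 - s) * \<delta> + s\<^sup>2 * D\<^sup>2"
    if "s \<in> {0..1}" for s using step(2)[OF _ _ _ l_in that] i by (simp add: \<delta>_def)
  have "F (Suc i) (y (Suc (Suc i))) - F (Suc i) (l (Suc i)) \<le> D\<^sup>2 * (4 * a\<^sup>2)"
  proof (cases "2 * a\<^sup>2 \<le> 1")
    case True
    \<comment> \<open>With \<open>s = 2 * a\<^sup>2\<close>, in units of
      \<open>D\<^sup>2 * a ^ 4\<close>: contraction of the old gap saves 8, the quadratic term costs
      4 and the new gradient at most 5/2, so the bound is preserved.\<close>
    have "F (Suc i) (y (Suc (Suc i))) - F (Suc i) (l (Suc i))
        \<le> (1 - 2 * a\<^sup>2) * \<delta> + (2 * a\<^sup>2)\<^sup>2 * D\<^sup>2"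
      using True a by (intro *) auto
    also have "\<dots> \<le> (1 - 2 * a\<^sup>2) * (D\<^sup>2 * (4 * a\<^sup>2 + 5 / 2 * a ^ 4)) + (2 * a\<^sup>2)\<^sup>2 * D\<^sup>2"
      using True \<delta> by (intro add_mono mult_left_mono) auto
    also have "\<dots> = D\<^sup>2 * (4 * a\<^sup>2) - D\<^sup>2 * (3 / 2 * a ^ 4 + 5 * a ^ 6)"
    proof -
      have "a ^ 4 = (a\<^sup>2)\<^sup>2" "a ^ 6 = (a\<^sup>2) ^ 3" by simp_all
      then show ?thesis by (simp only:) (simp add: field_simps power2_eq_square power3_eq_cube)
    qed
    also have "\<dots> \<le> D\<^sup>2 * (4 * a\<^sup>2)" using a by simp
    finally show ?thesis .
  next
    case False
    have "F (Suc i) (y (Suc (Suc i))) - F (Suc i) (l (Suc i)) \<le> D\<^sup>2 * 1"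
      using *[of 1] by simp
    also have "\<dots> \<le> D\<^sup>2 * (4 * a\<^sup>2)" using False by (intro mult_left_mono) auto
    finally show ?thesis .
  qed
  then show ?case using step(1) i unfolding q2 by auto
qed

text \<open>Induction on \<open>i\<close>: the next leader is a competitor of the current one for
  the current surrogate.\<close>

lemma be_the_leader: "i \<le> N \<Longrightarrow> \<eta> * (\<Sum>j<i. h (Suc j) \<bullet> l (Suc j)) \<le> F i (l i)"
proof (induction i)
  case 0
  then show ?case by (simp add: surrogate_def g0)
next
  case (Suc i)
  have "\<eta> * (\<Sum>j<Suc i. h (Suc j) \<bullet> l (Suc j)) \<le> F i (l i) + \<eta> * (h (Suc i) \<bullet> l (Suc i))"
    using Suc by (simp add: algebra_simps)
  also have "F i (l i) \<le> F i (l (Suc i))"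
    using surrogate_leader_le closed convex l_in by blast
  finally show ?case using Suc.prems F_Suc[of i] by simp
qed

lemma g_eq: "i \<le> N \<Longrightarrow> g i = (\<Sum>j<i. h (Suc j))"
  by (induction i) (auto simp: g0 g_Suc)

text \<open>The leader \<open>l (Suc i)\<close>, which already knows \<open>h (Suc i)\<close>, has
  regret at most \<open>D\<^sup>2 / \<eta>\<close>; using \<open>l i\<close> instead costs the
  movement of the leader.\<close>

lemma leader_regret:
  assumes u: "u \<in> K"
  shows "(\<Sum>i<N. h (Suc i) \<bullet> (l i - u)) \<le> D\<^sup>2 / \<eta> + real N * (\<eta> * G\<^sup>2 / 2)"
proof -
  have "\<eta> * (\<Sum>i<N. h (Suc i) \<bullet> l (Suc i)) \<le> F N u"
    using be_the_leader[of N] surrogate_leader_le[OF closed convex u, of \<eta> "y 1" "g N"] by simp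
  also have "\<dots> \<le> \<eta> * (\<Sum>i<N. h (Suc i) \<bullet> u) + D\<^sup>2"
    using diam[OF u y1] by (simp add: surrogate_def g_eq inner_sum_left power_mono)
  finally have "\<eta> * (\<Sum>i<N. h (Suc i) \<bullet> (l (Suc i) - u)) \<le> D\<^sup>2"
    by (simp add: inner_diff_right sum_subtractf right_diff_distrib)
  then have "(\<Sum>i<N. h (Suc i) \<bullet> (l (Suc i) - u)) \<le> D\<^sup>2 / \<eta>"
    using \<eta>_pos by (simp add: pos_le_divide_eq mult.commute)
  moreover have "(\<Sum>i<N. h (Suc i) \<bullet> (l i - l (Suc i))) \<le> (\<Sum>i<N. \<eta> * G\<^sup>2 / 2)"
  proof (rule sum_mono)
    fix i assume "i \<in> {..<N}"
    then have "norm (h (Suc i)) * norm (l i - l (Suc i)) \<le> G * (\<eta> * G / 2)"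
      using h_le[of "Suc i"] norm_l_step[of i] G_pos by (intro mult_mono) auto
    then show "h (Suc i) \<bullet> (l i - l (Suc i)) \<le> \<eta> * G\<^sup>2 / 2"
      using norm_cauchy_schwarz[of "h (Suc i)" "l i - l (Suc i)"]
      by (simp add: power2_eq_square algebra_simps)
  qed
  ultimately show ?thesis
    by (simp add: inner_diff_right sum_subtractf)
qed

text \<open>Here \<open>c i\<close> is the index of the iterate at which the gradient of update
  \<open>Suc i\<close> was evaluated, and \<open>Suc i - c i\<close> its lag.\<close>

lemma delayed_regret:
  assumes u: "u \<in> K" and c: "\<And>i. i < N \<Longrightarrow> 1 \<le> c i \<and> c i \<le> Suc i"
  shows "(\<Sum>i<N. h (Suc i) \<bullet> (y (c i) - u))
    \<le> real N * (2 * G * D / q) + \<eta> * G\<^sup>2 / 2 * (\<Sum>i<N. real (Suc i - c i))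
       + D\<^sup>2 / \<eta> + real N * (\<eta> * G\<^sup>2 / 2)"
proof -
  have "(\<Sum>i<N. h (Suc i) \<bullet> (y (c i) - l i))
      \<le> (\<Sum>i<N. 2 * G * D / q + \<eta> * G\<^sup>2 / 2 * real (Suc i - c i))"
  proof (rule sum_mono)
    fix i assume "i \<in> {..<N}"
    then have i: "i < N" by simp
    \<comment> \<open>The iterate \<open>y (Suc j)\<close> is near \<open>l j\<close>, the leader
      for the gradients it has seen; \<open>i - j\<close> leader moves, one per unit of lag, then
      lead to \<open>l i\<close>.\<close>
    obtain j where j: "c i = Suc j" "j \<le> i" using c[OF i] by (cases "c i") auto
    have "norm (y (Suc j) - l j) \<le> 2 * D / q"
      using gap[of j] j i by (intro gap_imp_norm) auto
    moreover have "norm (l j - l i) \<le> real (i - j) * (\<eta> * G / 2)"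
      using j i by (intro norm_l_diff) auto
    moreover have "norm (y (Suc j) - l i) \<le> norm (y (Suc j) - l j) + norm (l j - l i)"
      using norm_triangle_ineq[of "y (Suc j) - l j" "l j - l i"] by simp
    ultimately have "norm (y (Suc j) - l i) \<le> 2 * D / q + real (i - j) * (\<eta> * G / 2)"
      by linarith
    then have "norm (h (Suc i)) * norm (y (Suc j) - l i) \<le> G * (2 * D / q + real (i - j) * (\<eta> * G / 2))"
      using h_le[of "Suc i"] i G_pos by (intro mult_mono) auto
    then show "h (Suc i) \<bullet> (y (c i) - l i) \<le> 2 * G * D / q + \<eta> * G\<^sup>2 / 2 * real (Suc i - c i)"
      using norm_cauchy_schwarz[of "h (Suc i)" "y (Suc j) - l i"]
      by (simp add: j power2_eq_square algebra_simps)
  qed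
  then show ?thesis
    using leader_regret[OF u]
    by (simp add: inner_diff_right sum_subtractf sum.distrib sum_distrib_left)
qed

end

section \<open>Counting arrivals and delays\<close>

text \<open>Arrival sets of different rounds are disjoint, so the sum counts their union. Delays of
  at least 1 exclude an arrival in round 0, which the sum omits.\<close>

lemma counter_eq:
  assumes "\<forall>k\<in>{1..T}. d k \<ge> 1"
  shows "counter T d t = Suc (card {k \<in> {1..T}. k + d k - 1 < t})"
proof -
  have "(\<Sum>s\<in>{1..<t}. card (arrivals T d s)) = card (\<Union>s\<in>{1..<t}. arrivals T d s)"
    by (rule card_UN_disjoint[symmetric]) (auto simp: arrivals_def)
  also have "(\<Union>s\<in>{1..<t}. arrivals T d s) = {k \<in> {1..T}. k + d k - 1 < t}"
    using assms by (fastforce simp: arrivals_def)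
  finally show ?thesis by (simp add: counter_def)
qed

text \<open>Concatenating the lists \<open>order t\<close> gives one global processing order, sorted
  by arrival time, which replaces rounds by update indices. \<open>P\<close> abstracts the update
  relation.\<close>

lemma processing_list:
  fixes order :: "nat \<Rightarrow> nat list"
  assumes order: "\<And>t. t \<in> {1..T} \<Longrightarrow> distinct (order t) \<and> set (order t) = arrivals T d t
      \<and> (\<forall>j<length (order t). P (counter T d t + j) (order t ! j))"
    and d: "\<forall>k\<in>{1..T}. d k \<ge> 1"
  obtains L where "distinct L" "set L = {k \<in> {1..T}. k + d k - 1 \<le> T}"
    "sorted (map (\<lambda>k. k + d k - 1) L)" "\<And>i. i < length L \<Longrightarrow> P (Suc i) (L ! i)"
proof -
  have "t \<le> T \<Longrightarrow> \<exists>L. distinct L \<and> set L = {k \<in> {1..T}. k + d k - 1 \<le> t}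
    \<and> sorted (map (\<lambda>k. k + d k - 1) L) \<and> (\<forall>i < length L. P (Suc i) (L ! i))" for t
  proof (induction t)
    case 0
    have "{k \<in> {1..T}. k + d k - 1 \<le> 0} = {}" using d by fastforce
    then show ?case by (intro exI[of _ "[]"]) auto
  next
    case (Suc t)
    then obtain L where L: "distinct L" "set L = {k \<in> {1..T}. k + d k - 1 \<le> t}"
      "sorted (map (\<lambda>k. k + d k - 1) L)" "\<forall>i < length L. P (Suc i) (L ! i)" by auto
    have o: "distinct (order (Suc t))" "set (order (Suc t)) = arrivals T d (Suc t)"
      "\<forall>j<length (order (Suc t)). P (counter T d (Suc t) + j) (order (Suc t) ! j)"
      using order[of "Suc t"] Suc.prems by auto
    \<comment> \<open>The counter starts at 1, so the new block begins with the update right after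
      those of \<open>L\<close>.\<close>
    have len: "counter T d (Suc t) = Suc (length L)"
      using L(1,2) by (simp add: counter_eq[OF d] distinct_card[symmetric] less_Suc_eq_le)
    have "map (\<lambda>k. k + d k - 1) (order (Suc t)) = replicate (length (order (Suc t))) (Suc t)"
      using o(2) by (intro map_replicate_const[THEN trans[rotated]] map_cong) (auto simp: arrivals_def)
    then have "sorted (map (\<lambda>k. k + d k - 1) (L @ order (Suc t)))"
      using L by (auto simp: sorted_append)
    moreover have "P (Suc i) ((L @ order (Suc t)) ! i)" if "i < length (L @ order (Suc t))" for i
      using that L(4) o(3)[rule_format, of "i - length L"] len by (auto simp: nth_append)
    ultimately show ?case
      using L o by (intro exI[of _ "L @ order (Suc t)"]) (auto simp: arrivals_def)
  qed
  from this[of T] show ?thesis using that by auto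
qed

text \<open>The lag counts the gradients processed before that of round \<open>L ! i\<close>
  (\<open>A\<close> below) that had not arrived before this round was played (not in
  \<open>B\<close>). Since \<open>L\<close> is sorted by arrival time, \<open>B\<close> lies within
  \<open>A\<close>.\<close>

lemma counter_lag:
  assumes L: "distinct L" "set L = {k \<in> {1..T}. k + d k - 1 \<le> T}"
      "sorted (map (\<lambda>k. k + d k - 1) L)"
    and d: "\<forall>k\<in>{1..T}. d k \<ge> 1"
    and i: "i < length L"
  shows "counter T d (L ! i) \<le> Suc i"
    and "Suc i - counter T d (L ! i)
      \<le> (d (L ! i) - 1) + card {j \<in> set L. j < L ! i \<and> L ! i \<le> j + d j - 1}"
proof -
  define k where "k = L ! i"
  have k: "k \<in> {1..T}" "k + d k - 1 \<le> T" using nth_mem[OF i] L(2) by (auto simp: k_def)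
  note dk = d[rule_format, OF k(1)]
  define A where "A = set (take i L)"
  define B where "B = {j \<in> {1..T}. j + d j - 1 < k}"
  have "card A = i" using L(1) i by (simp add: A_def distinct_card)
  have le: "j + d j - 1 \<le> k + d k - 1 \<and> j \<noteq> k \<and> j \<in> set L" if jA: "j \<in> A" for j
  proof -
    obtain m where m: "m < i" "j = L ! m" using jA i by (auto simp: A_def in_set_conv_nth)
    then show ?thesis
      using sorted_nth_mono[OF L(3), of m i] L(1) i by (auto simp: k_def nth_eq_iff_index_eq)
  qed
  have "B \<subseteq> A"
  proof
    fix j assume j: "j \<in> B"
    then have "j \<in> set L" using k by (auto simp: B_def L(2))
    then obtain m where m: "m < length L" "j = L ! m" by (auto simp: in_set_conv_nth)
    have "m < i"
    proof (rule ccontr)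
      assume "\<not> m < i"
      then have "k + d k - 1 \<le> j + d j - 1"
        using sorted_nth_mono[OF L(3), of i m] m by (simp add: k_def)
      then show False using j dk by (simp add: B_def) arith
    qed
    then show "j \<in> A" using m i by (auto simp: A_def in_set_conv_nth)
  qed
  then have "card B \<le> i" "i - card B = card (A - B)"
    using \<open>card A = i\<close> card_mono[of A B] card_Diff_subset[of B A] finite_subset[of B A]
    by (auto simp: A_def)
  \<comment> \<open>Such a \<open>j\<close> arrives no later than \<open>k\<close> does, which
    bounds \<open>j\<close> itself if \<open>j > k\<close>; if \<open>j < k\<close>, its delay
    window contains \<open>k\<close>.\<close>
  moreover have "A - B \<subseteq> {k<..k + d k - 1} \<union> {j \<in> set L. j < k \<and> k \<le> j + d j - 1}"
  proof
    fix j assume j: "j \<in> A - B"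
    then have "j \<in> {1..T}" using le L(2) by auto
    then show "j \<in> {k<..k + d k - 1} \<union> {j \<in> set L. j < k \<and> k \<le> j + d j - 1}"
      using le[of j] j d[rule_format, of j] by (auto simp: B_def)
  qed
  then have "card (A - B) \<le> card ({k<..k + d k - 1} \<union> {j \<in> set L. j < k \<and> k \<le> j + d j - 1})"
    by (intro card_mono) auto
  then have "card (A - B) \<le> (d k - 1) + card {j \<in> set L. j < k \<and> k \<le> j + d j - 1}"
    using card_Un_le[of "{k<..k + d k - 1}" "{j \<in> set L. j < k \<and> k \<le> j + d j - 1}"] by simp
  moreover have "counter T d k = Suc (card B)" by (simp add: B_def counter_eq[OF d])
  ultimately show "counter T d (L ! i) \<le> Suc i"
    and "Suc i - counter T d (L ! i)
      \<le> (d (L ! i) - 1) + card {j \<in> set L. j < L ! i \<and> L ! i \<le> j + d j - 1}"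
    unfolding k_def by auto
qed

lemma sum_set_conv_nth:
  "distinct L \<Longrightarrow> (\<Sum>k\<in>set L. \<phi> k) = (\<Sum>i<length L. \<phi> (L ! i))"
  using sum.reindex_bij_betw[OF bij_betw_nth, of L "{..<length L}" "set L" \<phi>] by simp

text \<open>The gradients that overtake round \<open>k\<close> stem either from the \<open>d k - 1\<close> rounds after \<open>k\<close>, or from
  earlier rounds \<open>j\<close> with \<open>k\<close> in the delay window of \<open>j\<close>; counted from the side of \<open>j\<close>, the latter
  contribute another \<open>d j - 1\<close>.\<close>

lemma sum_counter_lag:
  assumes L: "distinct L" "set L = {k \<in> {1..T}. k + d k - 1 \<le> T}"
      "sorted (map (\<lambda>k. k + d k - 1) L)"
    and d: "\<forall>k\<in>{1..T}. d k \<ge> 1"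
  shows "(\<Sum>i<length L. Suc i - counter T d (L ! i)) \<le> 2 * (\<Sum>k\<in>set L. d k - 1)"
proof -
  have "(\<Sum>k\<in>set L. card {j \<in> set L. j < k \<and> k \<le> j + d j - 1})
      = (\<Sum>k\<in>set L. \<Sum>j\<in>{j \<in> set L. j < k \<and> k \<le> j + d j - 1}. 1)" by simp
  also have "\<dots> = (\<Sum>j\<in>set L. \<Sum>k\<in>{k \<in> set L. j < k \<and> k \<le> j + d j - 1}. 1)"
    by (rule sum.swap_restrict) auto
  also have "\<dots> \<le> (\<Sum>j\<in>set L. d j - 1)"
  proof (rule sum_mono)
    fix j
    have "card {k \<in> set L. j < k \<and> k \<le> j + d j - 1} \<le> card {j<..j + d j - 1}"
      by (rule card_mono) auto
    also have "\<dots> \<le> d j - 1" by simp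
    finally show "(\<Sum>k\<in>{k \<in> set L. j < k \<and> k \<le> j + d j - 1}. 1) \<le> d j - 1" by simp
  qed
  finally have swap: "(\<Sum>k\<in>set L. card {j \<in> set L. j < k \<and> k \<le> j + d j - 1}) \<le> (\<Sum>j\<in>set L. d j - 1)" .
  have "(\<Sum>i<length L. Suc i - counter T d (L ! i))
      \<le> (\<Sum>i<length L. (d (L ! i) - 1) + card {j \<in> set L. j < L ! i \<and> L ! i \<le> j + d j - 1})"
    using counter_lag(2)[OF L d] by (intro sum_mono) simp
  also have "\<dots> = (\<Sum>k\<in>set L. (d k - 1) + card {j \<in> set L. j < k \<and> k \<le> j + d j - 1})"
    by (simp only: sum_set_conv_nth[OF L(1)])
  finally show ?thesis using swap by (simp add: sum.distrib)
qed

text \<open>Of the rounds without feedback, at most \<open>r + 1\<close> are among the last ones; the others have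
  delay at least \<open>r\<close>.\<close>

lemma card_missing_le:
  fixes r :: real
  assumes "r > 0"
  shows "real (card {k \<in> {1..T}. T < k + d k - 1})
    \<le> r + 1 + (\<Sum>k\<in>{k \<in> {1..T}. T < k + d k - 1}. real (d k)) / r"
proof -
  let ?U = "{k \<in> {1..T}. T < k + d k - 1}"
  define m where "m = nat \<lceil>r\<rceil>"
  have m: "r \<le> real m" "real m \<le> r + 1"
    using assms of_int_ceiling_le_add_one[of r] by (auto simp: m_def)
  have "real (card ?U) = (\<Sum>k\<in>?U. 1)" by simp
  also have "\<dots> \<le> (\<Sum>k\<in>?U. of_bool (T - m < k) + real (d k) / r)"
  proof (rule sum_mono)
    fix k assume k: "k \<in> ?U"
    show "1 \<le> of_bool (T - m < k) + real (d k) / r"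
    proof (cases "T - m < k")
      case False
      then have "m \<le> d k" using k by auto
      then have "r \<le> real (d k)" using m by linarith
      then show ?thesis using assms by simp
    qed (use assms in simp)
  qed
  also have "\<dots> = real (card (?U \<inter> {k. T - m < k})) + (\<Sum>k\<in>?U. real (d k)) / r"
    by (simp add: sum.distrib sum_divide_distrib)
  also have "card (?U \<inter> {k. T - m < k}) \<le> card {T - m<..T}"
    by (rule card_mono) auto
  finally show ?thesis using m by simp
qed

section \<open>Combining the regret of received rounds with the cost of missing ones\<close>

theorem theorem1:
  fixes K :: "(real ^ 'n) set"
    and f :: "nat \<Rightarrow> real ^ 'n \<Rightarrow> real"
    and grad :: "nat \<Rightarrow> real ^ 'n \<Rightarrow> real ^ 'n"
    and x :: "nat \<Rightarrow> real ^ 'n"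
    and d :: "nat \<Rightarrow> nat"
    and T :: nat
    and D G :: real
  assumes "T \<ge> 1" and "D > 0" and "G > 0"
    and "closed K" and "convex K" and "0 \<in> K"
    and "\<And>u w. u \<in> K \<Longrightarrow> w \<in> K \<Longrightarrow> norm (u - w) \<le> D"
    and "\<And>t. t \<in> {1..T} \<Longrightarrow> convex_on K (f t)"
    and "\<And>t u. t \<in> {1..T} \<Longrightarrow> u \<in> K \<Longrightarrow>
           (f t has_derivative (\<lambda>h. h \<bullet> grad t u)) (at u within K)"
    and "\<And>t u. t \<in> {1..T} \<Longrightarrow> u \<in> K \<Longrightarrow> norm (grad t u) \<le> G"
    and "\<And>t. t \<in> {1..T} \<Longrightarrow> d t \<ge> 1"
    and "delayed_ofw T K d (D / (G * real T powr (3/4))) grad x"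
  shows "\<forall>x_star\<in>K.
           (\<Sum>t=1..T. f t (x t)) - (\<Sum>t=1..T. f t x_star)
             \<le> 7 * G * D * real T powr (3/4)
               + G * D * ((\<Sum>t=1..T. real (d t)) / real T + 1) * real T powr (1/4)"
proof
  fix u assume u: "u \<in> K"
  \<comment> \<open>All powers of \<open>T\<close> become integer powers of \<open>q\<close>:
    \<open>T = q ^ 4\<close>, and \<open>\<eta>\<close> has denominator
    \<open>G * q ^ 3\<close>.\<close>
  define q where "q = real T powr (1/4)"
  have T: "real T \<ge> 1" using assms(1) by simp
  have q: "q \<ge> 1" unfolding q_def using T by (intro ge_one_powr_ge_zero) auto
  have q4: "real T = q ^ 4" and q3: "real T powr (3/4) = q ^ 3"
    using T by (simp_all add: q_def powr_power)
  define \<eta> where "\<eta> = D / (G * q ^ 3)"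
  note D = assms(2) and G = assms(3) and diam = assms(7) and grad_le = assms(10)
  have d: "\<forall>k\<in>{1..T}. d k \<ge> 1" using assms(11) by blast
  obtain order g y v \<sigma> where y1: "y 1 \<in> K" and g0: "g 0 = 0"
    and run: "\<And>t. t \<in> {1..T} \<Longrightarrow> x t = y (counter T d t) \<and>
           distinct (order t) \<and> set (order t) = arrivals T d t \<and>
           (\<forall>j<length (order t).
              ofw_update K \<eta> g y v \<sigma> (counter T d t + j)
                (grad (order t ! j) (x (order t ! j))))"
    using assms(12) unfolding delayed_ofw_def q3 \<eta>_def by blast
  obtain L where L: "distinct L" "set L = {k \<in> {1..T}. k + d k - 1 \<le> T}"
      "sorted (map (\<lambda>k. k + d k - 1) L)"
    and upd: "\<And>i. i < length L \<Longrightarrow> ofw_update K \<eta> g y v \<sigma> (Suc i) (grad (L ! i) (x (L ! i)))"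
    using processing_list[of T order d "\<lambda>i k. ofw_update K \<eta> g y v \<sigma> i (grad k (x k))"] run d by blast
  define N where "N = length L"
  have N: "N = card (set L)" using L(1) by (simp add: N_def distinct_card)
  have "N \<le> card {1..T}" unfolding N by (intro card_mono) (auto simp: L(2))
  then have NT: "real N \<le> q ^ 4" by (simp flip: q4)
  define h where "h i = grad (L ! (i - 1)) (x (L ! (i - 1)))" for i
  have counter_le: "1 \<le> counter T d t \<and> counter T d t \<le> Suc N" if "t \<in> {1..T}" for t
    unfolding counter_eq[OF d] N using that by (auto intro!: card_mono simp: L(2))
  txt \<open>This cannot be taken from \<open>ofw_run\<close>: its bound on the gradients already requires the played
    points to lie in \<open>K\<close>.\<close>
  have "y (Suc i) \<in> K" if "i \<le> N" for i
    using that
  proof (induction i)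
    case (Suc i)
    then show ?case
      using frank_wolfe_step(1)[OF upd[of i] assms(5) _ diam] by (simp add: N_def)
  qed (use y1 in simp)
  then have yK: "y i \<in> K" if "1 \<le> i" "i \<le> Suc N" for i
    using that by (cases i) auto
  have xK: "x t \<in> K" if "t \<in> {1..T}" for t
    using run[OF that] yK counter_le[OF that] by simp
  have Lin: "L ! i \<in> {1..T}" if "i < N" for i
    using nth_mem[of i L] that L(2) by (auto simp: N_def)
  interpret ofw_run K D G q \<eta> g y v h \<sigma> N
  proof
    fix i assume "i \<in> {1..N}"
    then have i: "i - 1 < N" "Suc (i - 1) = i" by auto
    show "ofw_update K \<eta> g y v \<sigma> i (h i)"
      using upd[of "i - 1"] i unfolding h_def N_def by simp
    show "norm (h i) \<le> G"
      unfolding h_def using Lin[OF i(1)] by (intro grad_le xK) auto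
  qed (use assms q y1 g0 in \<open>auto simp: \<eta>_def\<close>)
  let ?\<phi> = "\<lambda>k. grad k (x k) \<bullet> (x k - u)"
  let ?U = "{k \<in> {1..T}. T < k + d k - 1}"
  have "f t (x t) - f t u \<le> ?\<phi> t" if t: "t \<in> {1..T}" for t
    using convex_on_above_tangent[OF assms(8)[OF t] xK[OF t] u assms(9)[OF t xK[OF t]]]
    by (simp add: inner_commute algebra_simps)
  then have "(\<Sum>t=1..T. f t (x t)) - (\<Sum>t=1..T. f t u) \<le> (\<Sum>t=1..T. ?\<phi> t)"
    unfolding sum_subtractf[symmetric] by (rule sum_mono)
  \<comment> \<open>Stated for arbitrary \<open>\<psi>\<close> because the total delay is later
    split in the same way.\<close>
  also have split: "(\<Sum>t=1..T. \<psi> t) = (\<Sum>k\<in>set L. \<psi> k) + (\<Sum>k\<in>?U. \<psi> k)" for \<psi> :: "nat \<Rightarrow> real"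
  proof -
    have "{1..T} = set L \<union> ?U" by (auto simp: L(2))
    moreover have "(\<Sum>t\<in>set L \<union> ?U. \<psi> t) = (\<Sum>k\<in>set L. \<psi> k) + (\<Sum>k\<in>?U. \<psi> k)"
      by (rule sum.union_disjoint) (auto simp: L(2))
    ultimately show ?thesis by (simp only:)
  qed
  also have "(\<Sum>k\<in>set L. ?\<phi> k) = (\<Sum>i<N. h (Suc i) \<bullet> (y (counter T d (L ! i)) - u))"
    unfolding sum_set_conv_nth[OF L(1)] N_def[symmetric] using run Lin
    by (intro sum.cong) (auto simp: h_def)
  also have "\<dots> \<le> real N * (2 * G * D / q)
       + \<eta> * G\<^sup>2 / 2 * (\<Sum>i<N. real (Suc i - counter T d (L ! i)))
       + D\<^sup>2 / \<eta> + real N * (\<eta> * G\<^sup>2 / 2)"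
    using counter_lag(1)[OF L d] counter_le Lin
    by (intro delayed_regret u) (auto simp: N_def)
  also have "\<dots> \<le> q ^ 4 * (2 * G * D / q) + \<eta> * G\<^sup>2 / 2 * (2 * (\<Sum>k\<in>set L. real (d k)))
       + D\<^sup>2 / \<eta> + q ^ 4 * (\<eta> * G\<^sup>2 / 2)"
  proof (intro add_mono mult_right_mono mult_left_mono NT order_refl)
    have "(\<Sum>i<N. real (Suc i - counter T d (L ! i))) \<le> real (2 * (\<Sum>k\<in>set L. d k - 1))"
      unfolding of_nat_sum[symmetric] N_def using sum_counter_lag[OF L d] by (rule of_nat_mono)
    also have "\<dots> \<le> 2 * (\<Sum>k\<in>set L. real (d k))"
      by (auto intro!: sum_mono)
    finally show "(\<Sum>i<N. real (Suc i - counter T d (L ! i))) \<le> 2 * (\<Sum>k\<in>set L. real (d k))" .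
  qed (use D G q \<eta>_pos in auto)
  \<comment> \<open>In units of \<open>G * D\<close>: the distance to the leaders gives
    \<open>2 * q ^ 3\<close>, \<open>D\<^sup>2 / \<eta>\<close> gives \<open>q ^ 3\<close>, the
    leader movement \<open>q / 2\<close>, and the lag the delay term.\<close>
  also have "\<dots> = G * D * (3 * q ^ 3 + q / 2 + (\<Sum>k\<in>set L. real (d k)) / q ^ 3)"
    using D G q by (simp add: \<eta>_def field_simps power2_eq_square numeral_eq_Suc)
  also have "(\<Sum>k\<in>?U. ?\<phi> k) \<le> (\<Sum>k\<in>?U. G * D)"
  proof (rule sum_mono)
    fix k assume "k \<in> ?U"
    then have "norm (grad k (x k)) * norm (x k - u) \<le> G * D"
      using grad_le xK diam u G by (intro mult_mono) auto
    then show "?\<phi> k \<le> G * D"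
      using norm_cauchy_schwarz[of "grad k (x k)" "x k - u"] by linarith
  qed
  also have "\<dots> = G * D * real (card ?U)" by simp
  \<comment> \<open>The threshold \<open>r = q ^ 3\<close> charges missing rounds
    \<open>1 / q ^ 3\<close> per unit of delay, the same rate as received ones, so the two delay
    sums merge.\<close>
  also have "\<dots> \<le> G * D * (q ^ 3 + 1 + (\<Sum>k\<in>?U. real (d k)) / q ^ 3)"
    using D G q card_missing_le[of "q ^ 3" T d] by (intro mult_left_mono) auto
  finally have "(\<Sum>t=1..T. f t (x t)) - (\<Sum>t=1..T. f t u)
      \<le> G * D * (4 * q ^ 3 + 1 + q / 2 + (\<Sum>t=1..T. real (d t)) / q ^ 3)"
    unfolding split[of "\<lambda>t. real (d t)"] by (simp add: algebra_simps add_divide_distrib)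
  also have "\<dots> \<le> G * D * (7 * q ^ 3 + q + (\<Sum>t=1..T. real (d t)) / q ^ 3)"
  proof -
    have "1 \<le> q ^ 3" using q by simp
    then have "4 * q ^ 3 + 1 + q / 2 \<le> 7 * q ^ 3 + q" using q by linarith
    then show ?thesis using D G by (intro mult_left_mono add_right_mono) auto
  qed
  also have "\<dots> = 7 * G * D * real T powr (3/4)
      + G * D * ((\<Sum>t=1..T. real (d t)) / real T + 1) * real T powr (1/4)"
    unfolding q3 q_def[symmetric] unfolding q4 using q by (simp add: field_simps numeral_eq_Suc)
  finally show "(\<Sum>t=1..T. f t (x t)) - (\<Sum>t=1..T. f t u)
      \<le> 7 * G * D * real T powr (3/4)
        + G * D * ((\<Sum>t=1..T. real (d t)) / real T + 1) * real T powr (1/4)" .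
qed

end
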